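(* Let $H$ be a homogeneous relation of local congruence $2$ on a finite set $X$ such that the family $\mathcal{U}_H$ of umodules of $H$ is self-complemented. Let $s\in X$ and let $U\subseteq X$ be a subset containing $s$. Then $U$ is a umodule of $H$ if and only if $M=X\setminus U$ is a module of the Seidel switch $H(s)$.
   Context: Let $X$ be a finite set. A reflectless triple is $(x|yz)$ with $x,y,z\in X$, $x\neq y$, $x\neq z$. A homogeneous relation $H$ on $X$ is a boolean relation on reflectless triples such that for every $x\in X$ the binary relation $H_x$ on $X\setminus\{x\}$ given by $H_x(y,z)\Leftrightarrow H(x|yz)$ is an equivalence relation; equivalently, it assigns to each $x\in X$ a partition of $X\setminus\{x\}$ (the classes of $H_x$). A subset $M\subseteq X$ is a module of $H$ if $H(x|mm')$ for all $m,m'\in M$ and $x\in X\setminus M$. A subset $U\subseteq X$ is a umodule of $H$ if for all $u,u'\in U$ and all $x,x'\in X\setminus U$: $H(u|xx')\Leftrightarrow H(u'|xx')$. The family of umodules $\mathcal{U}_H$ is self-complemented if $U\in\mathcal{U}_H$ implies $X\setminus U\in\mathcal{U}_H$. The local congruence of $H$ is the maximum over $x\in X$ of the number of equivalence classes of $H_x$. If it is $2$, write $H_x^1,H_x^2$ for the classes of $H_x$ (one, or both, of them taken to be empty if $H_x$ has fewer than two classes). Seidel switch: for $H$ of local congruence $2$ on $X$ and $s\in X$, $H(s)$ is the homogeneous relation on $X\setminus\{s\}$ whose classes at each $x\in X\setminus\{s\}$ are $$H(s)_x^1=(H_x^1\,\Delta\, H_s^j)\setminus\{s\},\qquad H(s)_x^2=(H_x^2\,\Delta\,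 H_s^j)\setminus\{s\},$$ where $j\in\{1,2\}$ is such that $x\notin H_s^j$ and $\Delta$ denotes symmetric difference (empty classes being discarded). *)

theory Defs
  imports Main
begin

text \<open>
  A relation on reflectless triples over \<open>X\<close> is a ternary predicate \<open>H\<close>, where \<open>H x y z\<close> stands
  for \<open>H(x|yz)\<close>. Its values on other triples are arbitrary and no definition below depends on them.
\<close>

definition local_rel :: "'a set \<Rightarrow> ('a \<Rightarrow> 'a \<Rightarrow> 'a \<Rightarrow> bool) \<Rightarrow> 'a \<Rightarrow> 'a rel" where
  "local_rel X H x = {(y, z). y \<in> X - {x} \<and> z \<in> X - {x} \<and> H x y z}"

definition homogeneous :: "'a set \<Rightarrow> ('a \<Rightarrow> 'a \<Rightarrow> 'a \<Rightarrow> bool) \<Rightarrow> bool" where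
  "homogeneous X H \<longleftrightarrow> (\<forall>x\<in>X. equiv (X - {x}) (local_rel X H x))"

definition local_classes :: "'a set \<Rightarrow> ('a \<Rightarrow> 'a \<Rightarrow> 'a \<Rightarrow> bool) \<Rightarrow> 'a \<Rightarrow> 'a set set" where
  "local_classes X H x = (X - {x}) // local_rel X H x"

definition local_congruence :: "'a set \<Rightarrow> ('a \<Rightarrow> 'a \<Rightarrow> 'a \<Rightarrow> bool) \<Rightarrow> nat" where
  "local_congruence X H = Max ((\<lambda>x. card (local_classes X H x)) ` X)"

definition is_module :: "'a set \<Rightarrow> ('a \<Rightarrow> 'a \<Rightarrow> 'a \<Rightarrow> bool) \<Rightarrow> 'a set \<Rightarrow> bool" where
  "is_module X H M \<longleftrightarrow> M \<subseteq> X \<and> (\<forall>m\<in>M. \<forall>m'\<in>M. \<forall>x\<in>X - M. H x m m')"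

definition is_umodule :: "'a set \<Rightarrow> ('a \<Rightarrow> 'a \<Rightarrow> 'a \<Rightarrow> bool) \<Rightarrow> 'a set \<Rightarrow> bool" where
  "is_umodule X H U \<longleftrightarrow>
     U \<subseteq> X \<and> (\<forall>u\<in>U. \<forall>u'\<in>U. \<forall>x\<in>X - U. \<forall>x'\<in>X - U. H u x x' \<longleftrightarrow> H u' x x')"

definition umodules :: "'a set \<Rightarrow> ('a \<Rightarrow> 'a \<Rightarrow> 'a \<Rightarrow> bool) \<Rightarrow> 'a set set" where
  "umodules X H = {U. is_umodule X H U}"

definition self_complemented :: "'a set \<Rightarrow> 'a set set \<Rightarrow> bool" where
  "self_complemented X F \<longleftrightarrow> (\<forall>U\<in>F. X - U \<in> F)"

text \<open>
  For local congruence 2, the unordered pair \<open>{H\<^sub>x\<^sup>1, H\<^sub>x\<^sup>2}\<close>: the classes of \<open>H\<^sub>x\<close>, filled up with the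
  empty set if there are fewer than two. The numbering of the two classes plays no role in the
  Seidel switch.
\<close>

definition local_parts :: "'a set \<Rightarrow> ('a \<Rightarrow> 'a \<Rightarrow> 'a \<Rightarrow> bool) \<Rightarrow> 'a \<Rightarrow> 'a set set" where
  "local_parts X H x =
     (if card (local_classes X H x) < 2 then insert {} (local_classes X H x)
      else local_classes X H x)"

text \<open>The part \<open>H\<^sub>s\<^sup>j\<close> with \<open>x \<notin> H\<^sub>s\<^sup>j\<close>; unique by lemma \<open>ex1_opposite_part\<close> below.\<close>

definition opposite_part :: "'a set \<Rightarrow> ('a \<Rightarrow> 'a \<Rightarrow> 'a \<Rightarrow> bool) \<Rightarrow> 'a \<Rightarrow> 'a \<Rightarrow> 'a set" where
  "opposite_part X H s x = (THE B. B \<in> local_parts X H s \<and> x \<notin> B)"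

definition seidel_classes :: "'a set \<Rightarrow> ('a \<Rightarrow> 'a \<Rightarrow> 'a \<Rightarrow> bool) \<Rightarrow> 'a \<Rightarrow> 'a \<Rightarrow> 'a set set" where
  "seidel_classes X H s x =
     {sym_diff A (opposite_part X H s x) - {s} | A. A \<in> local_parts X H x} - {{}}"

definition seidel_switch ::
  "'a set \<Rightarrow> ('a \<Rightarrow> 'a \<Rightarrow> 'a \<Rightarrow> bool) \<Rightarrow> 'a \<Rightarrow> ('a \<Rightarrow> 'a \<Rightarrow> 'a \<Rightarrow> bool)" where
  "seidel_switch X H s x y z \<longleftrightarrow> (\<exists>C\<in>seidel_classes X H s x. y \<in> C \<and> z \<in> C)"

lemma local_parts_two:
  assumes fin: "finite X" and hom: "homogeneous X H" and cong: "local_congruence X H = 2"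
    and x: "x \<in> X" and ne: "X - {x} \<noteq> {}"
  obtains A B where "local_parts X H x = {A, B}" "A \<noteq> B" "A \<union> B = X - {x}" "A \<inter> B = {}"
proof -
  let ?C = "local_classes X H x"
  have eq: "equiv (X - {x}) (local_rel X H x)"
    using hom x by (auto simp: homogeneous_def)
  have un: "\<Union>?C = X - {x}"
    unfolding local_classes_def by (rule Union_quotient[OF eq])
  have dis: "A = B \<or> A \<inter> B = {}" if "A \<in> ?C" "B \<in> ?C" for A B
    using quotient_disj[OF eq] that unfolding local_classes_def by blast
  have nemp: "{} \<notin> ?C"
    using in_quotient_imp_non_empty[OF eq] unfolding local_classes_def by blast
  have "?C \<subseteq> Pow (X - {x})" using un by blast
  then have finC: "finite ?C" using fin by (meson finite_Diff finite_Pow_iff finite_subset)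
  have "card ?C \<le> 2"
    using cong fin x unfolding local_congruence_def
    by (metis (no_types, lifting) Max_ge finite_imageI imageI)
  moreover have "card ?C \<noteq> 0" using un ne finC by auto
  ultimately consider "card ?C = 1" | "card ?C = 2" by linarith
  then show thesis
  proof cases
    case 1
    then obtain A where A: "?C = {A}" by (auto simp: card_1_singleton_iff)
    have "local_parts X H x = {{}, A}" using 1 A by (simp add: local_parts_def)
    then show thesis using that[of "{}" A] un A nemp by auto
  next
    case 2
    then obtain A B where AB: "?C = {A, B}" "A \<noteq> B" by (auto simp: card_2_iff)
    have "local_parts X H x = {A, B}" using 2 AB by (simp add: local_parts_def)
    then show thesis using that[of A B] un AB dis[of A B] by auto
  qed
qed

lemma ex1_opposite_part:
  assumes "finite X" "homogeneous X H" "local_congruence X H = 2" "s \<in> X" "x \<in> X - {s}"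
  shows "\<exists>!B. B \<in> local_parts X H s \<and> x \<notin> B"
proof -
  obtain A B where AB: "local_parts X H s = {A, B}" "A \<union> B = X - {s}" "A \<inter> B = {}"
    by (rule local_parts_two[OF assms(1-4)]) (use assms(5) in auto)
  then have "x \<in> A \<and> x \<notin> B \<or> x \<in> B \<and> x \<notin> A"
    using assms(5) by blast
  then show ?thesis unfolding AB(1) by blast
qed

lemma seidel_classes_partition:
  assumes "finite X" "homogeneous X H" "local_congruence X H = 2" "s \<in> X" "x \<in> X - {s}"
  shows "\<Union>(seidel_classes X H s x) = X - {s} - {x}"
    and "\<And>C D. C \<in> seidel_classes X H s x \<Longrightarrow> D \<in> seidel_classes X H s x \<Longrightarrow> C = D \<or> C \<inter> D = {}"
proof -
  let ?N = "opposite_part X H s x"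
  obtain A B where AB: "local_parts X H x = {A, B}" "A \<union> B = X - {x}" "A \<inter> B = {}"
    by (rule local_parts_two[OF assms(1-3), of x]) (use assms(4,5) in auto)
  obtain P Q where PQ: "local_parts X H s = {P, Q}" "P \<union> Q = X - {s}"
    by (rule local_parts_two[OF assms(1-4)]) (use assms(5) in auto)
  have "?N \<in> local_parts X H s \<and> x \<notin> ?N"
    unfolding opposite_part_def by (rule theI'[OF ex1_opposite_part[OF assms]])
  then have N: "?N \<subseteq> X - {s} - {x}" using PQ by blast
  have cl: "seidel_classes X H s x = {sym_diff A ?N - {s}, sym_diff B ?N - {s}} - {{}}"
    unfolding seidel_classes_def AB(1) by blast
  have "\<Union>(seidel_classes X H s x) = (sym_diff A ?N - {s}) \<union> (sym_diff B ?N - {s})"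
    unfolding cl by blast
  also have "\<dots> = X - {s} - {x}" using AB(2,3) N by blast
  finally show "\<Union>(seidel_classes X H s x) = X - {s} - {x}" .
  have "(sym_diff A ?N - {s}) \<inter> (sym_diff B ?N - {s}) = {}" using AB(2,3) N by auto
  then show "C = D \<or> C \<inter> D = {}"
    if "C \<in> seidel_classes X H s x" "D \<in> seidel_classes X H s x" for C D
    using that unfolding cl by blast
qed

lemma homogeneous_seidel_switch:
  assumes "finite X" "homogeneous X H" "local_congruence X H = 2" "s \<in> X"
  shows "homogeneous (X - {s}) (seidel_switch X H s)"
  unfolding homogeneous_def
proof
  fix x assume x: "x \<in> X - {s}"
  note P = seidel_classes_partition[OF assms x]
  let ?r = "local_rel (X - {s}) (seidel_switch X H s) x"
  have "?r \<subseteq> (X - {s} - {x}) \<times> (X - {s} - {x})"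
    by (auto simp: local_rel_def)
  moreover have "refl_on (X - {s} - {x}) ?r"
    using P(1) by (auto simp: refl_on_def local_rel_def seidel_switch_def)
  moreover have "sym ?r"
    by (auto simp: sym_def local_rel_def seidel_switch_def)
  moreover have "trans ?r"
  proof (rule transI)
    fix a b c assume "(a, b) \<in> ?r" "(b, c) \<in> ?r"
    then obtain C D where CD: "C \<in> seidel_classes X H s x" "D \<in> seidel_classes X H s x"
        "a \<in> C" "b \<in> C" "b \<in> D" "c \<in> D" "a \<in> X - {s} - {x}" "c \<in> X - {s} - {x}"
      unfolding local_rel_def seidel_switch_def by auto
    then have "C = D" using P(2)[OF CD(1,2)] by auto
    then show "(a, c) \<in> ?r" using CD unfolding local_rel_def seidel_switch_def by auto
  qed
  ultimately show "equiv (X - {s} - {x}) ?r"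
    by (simp add: equiv_def)
qed

lemma local_classes_seidel_switch:
  assumes "finite X" "homogeneous X H" "local_congruence X H = 2" "s \<in> X" "x \<in> X - {s}"
  shows "local_classes (X - {s}) (seidel_switch X H s) x = seidel_classes X H s x"
proof -
  note P = seidel_classes_partition[OF assms]
  let ?r = "local_rel (X - {s}) (seidel_switch X H s) x"
  have img: "?r `` {y} = C" if "C \<in> seidel_classes X H s x" "y \<in> C" for y C
  proof -
    have eq: "D = C" if "D \<in> seidel_classes X H s x" "y \<in> D" for D
      using P(2)[OF that(1) \<open>C \<in> _\<close>] that \<open>y \<in> C\<close> by auto
    have sub: "C \<subseteq> X - {s} - {x}" using P(1) \<open>C \<in> _\<close> by blast
    have "(y, z) \<in> ?r \<longleftrightarrow> z \<in> C" for z
    proof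
      assume "(y, z) \<in> ?r"
      then obtain D where "D \<in> seidel_classes X H s x" "y \<in> D" "z \<in> D"
        unfolding local_rel_def seidel_switch_def by auto
      then show "z \<in> C" using eq by metis
    next
      assume "z \<in> C"
      then have "y \<in> X - {s} - {x}" "z \<in> X - {s} - {x}" "seidel_switch X H s x y z"
        using sub that by (auto simp only: seidel_switch_def)
      then show "(y, z) \<in> ?r" by (simp add: local_rel_def)
    qed
    then show ?thesis by (simp add: set_eq_iff)
  qed
  have ne: "C \<noteq> {}" if "C \<in> seidel_classes X H s x" for C
    using that by (simp add: seidel_classes_def)
  show ?thesis
  proof (rule set_eqI)
    fix C
    show "C \<in> local_classes (X - {s}) (seidel_switch X H s) x \<longleftrightarrow> C \<in> seidel_classes X H s x"
    proof
      assume "C \<in> local_classes (X - {s}) (seidel_switch X H s) x"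
      then obtain y where y: "y \<in> X - {s} - {x}" "C = ?r `` {y}"
        unfolding local_classes_def by (rule quotientE)
      then obtain D where "D \<in> seidel_classes X H s x" "y \<in> D" using P(1) by blast
      then show "C \<in> seidel_classes X H s x" using img y by simp
    next
      assume C: "C \<in> seidel_classes X H s x"
      then obtain y where y: "y \<in> C" using ne by blast
      then have "y \<in> X - {s} - {x}" using C P(1) by blast
      then show "C \<in> local_classes (X - {s}) (seidel_switch X H s) x"
        unfolding local_classes_def img[OF C y, symmetric] by (rule quotientI)
    qed
  qed
qed

end

(* With at most two classes at each point, H(x|yz) says that y and z lie on the same side of one
   bipartition of X - {x}. Taking the symmetric difference of two bipartitions amounts to taking the
   biconditional of the two same-side relations, so H(s)(x|yz) holds iff H(x|yz) and H(s|yz) agree.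
   Hence X - U is a module of H(s) iff every u in U agrees with s on X - U, that is, iff any two
   elements of U agree there. *)

theory Submission
  imports Defs
begin

text \<open>The two parts are complementary in \<open>X - {x}\<close>, so two points lie on the same
  side of one part iff they lie on the same side of the other. A nonempty part is a class of
  \<open>local_rel X H x\<close>, which makes lying in a common part equivalent to being
  related.\<close>

lemma local_parts_iff:
  assumes "finite X" "homogeneous X H" "local_congruence X H = 2" "x \<in> X"
    and C: "C \<in> local_parts X H x" and yz: "y \<in> X - {x}" "z \<in> X - {x}"
  shows "H x y z \<longleftrightarrow> (y \<in> C \<longleftrightarrow> z \<in> C)"
proof -
  obtain A B where AB: "local_parts X H x = {A, B}" "A \<union> B = X - {x}" "A \<inter> B = {}"
    by (rule local_parts_two[OF assms(1-4)]) (use yz in auto)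
  have eq: "equiv (X - {x}) (local_rel X H x)"
    using assms(2,4) by (auto simp: homogeneous_def)
  \<comment> \<open>Nonemptiness excludes the padding \<open>{}\<close>, which is not a class.
    Below, \<open>D\<close> always contains \<open>v\<close>.\<close>
  have cls: "D \<in> (X - {x}) // local_rel X H x" if "D \<in> local_parts X H x" "D \<noteq> {}" for D
    using that by (auto simp: local_parts_def local_classes_def split: if_splits)
  have rel: "H x v w" if "D \<in> local_parts X H x" "v \<in> D" "w \<in> D" for D v w
  proof -
    have "(v, w) \<in> local_rel X H x"
      by (rule in_quotient_imp_in_rel[OF eq cls[of D]]) (use that in auto)
    then show ?thesis by (simp add: local_rel_def)
  qed
  have closed: "w \<in> D" if "D \<in> local_parts X H x" "v \<in> D" "w \<in> X - {x}" "H x v w" for D v w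
  proof (rule in_quotient_imp_closed[OF eq cls[of D]])
    show "(v, w) \<in> local_rel X H x"
      using that AB by (auto simp: local_rel_def)
  qed (use that in auto)
  have A: "A \<in> local_parts X H x" and B: "B \<in> local_parts X H x"
    using AB(1) by auto
  have opp: "y \<in> B \<longleftrightarrow> y \<notin> A" "z \<in> B \<longleftrightarrow> z \<notin> A"
    using AB(2,3) yz by blast+
  have "H x y z \<longleftrightarrow> (y \<in> A \<longleftrightarrow> z \<in> A)"
    using rel[OF A, of y z] rel[OF B, of y z] closed[OF A, of y z] closed[OF B, of y z] yz opp
    by metis
  then show ?thesis
    using C AB(1) opp by auto
qed

lemma seidel_switch_iff:
  assumes "finite X" "homogeneous X H" "local_congruence X H = 2" "s \<in> X" "x \<in> X - {s}"
    and yz: "y \<in> X - {s, x}" "z \<in> X - {s, x}"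
  shows "seidel_switch X H s x y z \<longleftrightarrow> (H x y z \<longleftrightarrow> H s y z)"
proof -
  let ?N = "opposite_part X H s x"
  have x: "x \<in> X" using assms(5) by blast
  obtain A B where AB: "local_parts X H x = {A, B}" "A \<union> B = X - {x}" "A \<inter> B = {}"
    by (rule local_parts_two[OF assms(1-3) x]) (use yz in auto)
  have "?N \<in> local_parts X H s \<and> x \<notin> ?N"
    unfolding opposite_part_def by (rule theI'[OF ex1_opposite_part[OF assms(1-5)]])
  then have Hs: "H s y z \<longleftrightarrow> (y \<in> ?N \<longleftrightarrow> z \<in> ?N)"
    using local_parts_iff[OF assms(1-4), of ?N y z] yz by simp
  have Hx: "H x y z \<longleftrightarrow> (y \<in> A \<longleftrightarrow> z \<in> A)"
    using local_parts_iff[OF assms(1-3) x, of A y z] AB(1) yz by simp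
  have "seidel_switch X H s x y z \<longleftrightarrow>
      (y \<in> sym_diff A ?N \<and> z \<in> sym_diff A ?N) \<or> (y \<in> sym_diff B ?N \<and> z \<in> sym_diff B ?N)"
  proof -
    have "seidel_classes X H s x = {sym_diff A ?N - {s}, sym_diff B ?N - {s}} - {{}}"
      unfolding seidel_classes_def AB(1) by blast
    \<comment> \<open>Discarding \<open>{}\<close> is harmless, since a witness \<open>C\<close>
      contains \<open>y\<close>.\<close>
    then have "seidel_switch X H s x y z \<longleftrightarrow>
        (\<exists>C\<in>{sym_diff A ?N - {s}, sym_diff B ?N - {s}}. y \<in> C \<and> z \<in> C)"
      unfolding seidel_switch_def by (metis Diff_iff empty_iff singletonD)
    then show ?thesis using yz by simp
  qed
  \<comment> \<open>For \<open>y\<close> and \<open>z\<close>, membership in \<open>B\<close>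
    negates membership in \<open>A\<close>, and this survives the symmetric difference with
    \<open>?N\<close>. So they share one of the two sets iff they lie on the same side of
    \<open>sym_diff A ?N\<close>.\<close>
  also have "\<dots> \<longleftrightarrow> ((y \<in> A \<longleftrightarrow> z \<in> A) \<longleftrightarrow> (y \<in> ?N \<longleftrightarrow> z \<in> ?N))"
  proof -
    have "y \<in> B \<longleftrightarrow> y \<notin> A" "z \<in> B \<longleftrightarrow> z \<notin> A"
      using AB(2,3) yz by blast+
    then show ?thesis by auto
  qed
  finally show ?thesis using Hs Hx by simp
qed

theorem theorem5:
  fixes X :: "'a set" and H :: "'a \<Rightarrow> 'a \<Rightarrow> 'a \<Rightarrow> bool" and s :: 'a and U :: "'a set"
  assumes "finite X"
    and "homogeneous X H"
    and "local_congruence X H = 2"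
    and "self_complemented X (umodules X H)"
    and "s \<in> X"
    and "U \<subseteq> X"
    and "s \<in> U"
  shows "is_umodule X H U \<longleftrightarrow> is_module (X - {s}) (seidel_switch X H s) (X - U)"
proof -
  have "is_module (X - {s}) (seidel_switch X H s) (X - U) \<longleftrightarrow>
      (\<forall>m\<in>X - U. \<forall>m'\<in>X - U. \<forall>u\<in>U - {s}. seidel_switch X H s u m m')"
  proof -
    \<comment> \<open>Since \<open>s\<close> lies in \<open>U\<close>, the points outside the module
      in the smaller ground set are those of \<open>U - {s}\<close>.\<close>
    have "X - {s} - (X - U) = U - {s}" "X - U \<subseteq> X - {s}"
      using assms(6,7) by auto
    then show ?thesis by (simp add: is_module_def)
  qed
  also have "\<dots> \<longleftrightarrow> (\<forall>m\<in>X - U. \<forall>m'\<in>X - U. \<forall>u\<in>U - {s}. H u m m' \<longleftrightarrow> H s m m')"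
  proof (intro ball_cong refl)
    fix m m' u assume "m \<in> X - U" "m' \<in> X - U" "u \<in> U - {s}"
    then show "seidel_switch X H s u m m' \<longleftrightarrow> (H u m m' \<longleftrightarrow> H s m m')"
      \<comment> \<open>Both \<open>s\<close> and \<open>u\<close> lie in \<open>U\<close>, so
        \<open>m\<close> and \<open>m'\<close> differ from them.\<close>
      using assms(6,7) by (intro seidel_switch_iff[OF assms(1,2,3,5)]) auto
  qed
  also have "\<dots> \<longleftrightarrow> is_umodule X H U"
  proof
    assume agree: "\<forall>m\<in>X - U. \<forall>m'\<in>X - U. \<forall>u\<in>U - {s}. H u m m' \<longleftrightarrow> H s m m'"
    \<comment> \<open>The case \<open>u = s\<close> is trivial; two elements of \<open>U\<close> are
      then compared through \<open>s\<close>.\<close>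
    have "H u m m' \<longleftrightarrow> H s m m'" if "u \<in> U" "m \<in> X - U" "m' \<in> X - U" for u m m'
      using agree that by (cases "u = s") auto
    then show "is_umodule X H U"
      using assms(6) by (simp add: is_umodule_def)
  next
    assume "is_umodule X H U"
    then show "\<forall>m\<in>X - U. \<forall>m'\<in>X - U. \<forall>u\<in>U - {s}. H u m m' \<longleftrightarrow> H s m m'"
      using assms(7) unfolding is_umodule_def by (meson DiffD1)
  qed
  finally show ?thesis by simp
qed

end
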